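(* Let $n$ be a positive integer, let $K$ be a discrete box of dimension $n$, and let $\mathcal F$ be a cover of $K$ (a family of subsets of $K$ whose union is $K$). Then either some set $F\in\mathcal F$ connects two opposite faces of $K$, or there exists a subset $B\subseteq K$ of diameter $\le 1$ (with respect to the metric $d$ of $K$) that intersects at least $n+1$ elements of the cover $\mathcal F$.
   Context: A discrete box of dimension $n$ is a product $K=k_1\times\dots\times k_n$ of nonzero finite ordinals $k_1,\dots,k_n$, where each finite ordinal $k$ is identified with $\{0,\dots,k-1\}$. Elements of $K$ are functions $x:\{1,\dots,n\}\to\{0,1,2,\dots\}$ with $x(i)\in\{0,\dots,k_i-1\}$ for all $i$. The box $K$ is endowed with the metric $d(x,y)=\max_{1\le i\le n}|x(i)-y(i)|$. A set $F\subseteq K$ connects two opposite faces of $K=k_1\times\dots\times k_n$ if there exist $i\in\{1,\dots,n\}$ and a sequence of points $x_0,\dots,x_m\in F$ such that $x_0(i)=0$, $x_m(i)=k_i-1$, and $d(x_{j-1},x_j)\le 1$ for all $j\in\{1,\dots,m\}$. *)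

theory Defs
  imports Complex_Main "HOL-Library.FuncSet"
begin

(* The extensional product makes functions that agree on {1..n} equal, so box_dist
   separates points of the box. The side lengths k i are meant to be positive. *)
definition discrete_box :: "nat \<Rightarrow> (nat \<Rightarrow> nat) \<Rightarrow> (nat \<Rightarrow> nat) set" where
  "discrete_box n k = (\<Pi>\<^sub>E i\<in>{1..n}. {0..<k i})"

definition box_dist :: "nat \<Rightarrow> (nat \<Rightarrow> nat) \<Rightarrow> (nat \<Rightarrow> nat) \<Rightarrow> real" where
  "box_dist n x y = (MAX i\<in>{1..n}. \<bar>real (x i) - real (y i)\<bar>)"

(* Same shape as the type-class constant diameter in HOL-Analysis, for the metric box_dist n. *)
definition box_diameter :: "nat \<Rightarrow> (nat \<Rightarrow> nat) set \<Rightarrow> real" where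
  "box_diameter n B = (if B = {} then 0 else SUP (x, y)\<in>B \<times> B. box_dist n x y)"

(* The truncated subtraction k i - 1 is harmless because k i > 0 in every box. *)
definition connects_opposite_faces :: "nat \<Rightarrow> (nat \<Rightarrow> nat) \<Rightarrow> (nat \<Rightarrow> nat) set \<Rightarrow> bool" where
  "connects_opposite_faces n k F \<longleftrightarrow>
     (\<exists>i\<in>{1..n}. \<exists>(m::nat) (x :: nat \<Rightarrow> nat \<Rightarrow> nat).
        (\<forall>j\<in>{0..m}. x j \<in> F) \<and> x 0 i = 0 \<and> x m i = k i - 1 \<and>
        (\<forall>j\<in>{1..m}. box_dist n (x (j - 1)) (x j) \<le> 1))"

end

theory Submission
  imports Defs "HOL-Analysis.Brouwer_Fixpoint"
begin

text \<open>
  Choose for every point x of the box a member c x of the cover containing it, and label x in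
  direction i by 0 if x is chained inside c x to the face \<open>x i = 0\<close>, and by 1 otherwise. If no member
  of the cover connects opposite faces, this is a labelling as in Kuhn's combinatorial lemma, which
  yields a simplex whose vertices carry all n + 1 reduced labels. Vertices of a simplex are at
  distance at most 1, so two vertices with the same member of the cover are chained to each other in
  it and have equal labels; hence the simplex meets n + 1 members. A box with unequal sides is
  reduced to a cube by clamping coordinates, which does not increase distances.
\<close>

lemma box_dist_le_1:
  assumes "n > 0" "\<And>i. i \<in> {1..n} \<Longrightarrow> x i \<le> y i + 1 \<and> y i \<le> x i + 1"
  shows "box_dist n x y \<le> 1"
proof -
  have "\<bar>real (x i) - real (y i)\<bar> \<le> 1" if "i \<in> {1..n}" for i
    using assms(2)[OF that] by linarith
  then show ?thesis
    using assms(1) by (auto simp: box_dist_def)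
qed

lemma box_diameter_le_1:
  assumes "\<And>x y. x \<in> B \<Longrightarrow> y \<in> B \<Longrightarrow> box_dist n x y \<le> 1"
  shows "box_diameter n B \<le> 1"
  using assms by (auto simp: box_diameter_def intro!: cSUP_least)

definition chain_step :: "nat \<Rightarrow> (nat \<Rightarrow> nat) set \<Rightarrow> (nat \<Rightarrow> nat) \<Rightarrow> (nat \<Rightarrow> nat) \<Rightarrow> bool" where
  "chain_step n F x y \<longleftrightarrow> x \<in> F \<and> y \<in> F \<and> box_dist n x y \<le> 1"

text \<open>The reflexive closure relates every point to itself, so \<open>z \<in> F\<close> is
  demanded separately to keep chains of length 0 inside \<open>F\<close>.\<close>

definition reaches_zero_face :: "nat \<Rightarrow> (nat \<Rightarrow> nat) set \<Rightarrow> nat \<Rightarrow> (nat \<Rightarrow> nat) \<Rightarrow> bool" where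
  "reaches_zero_face n F i x \<longleftrightarrow> (\<exists>z\<in>F. z i = 0 \<and> (chain_step n F)\<^sup>*\<^sup>* z x)"

lemma reaches_zero_face_step:
  "reaches_zero_face n F i x \<Longrightarrow> chain_step n F x y \<Longrightarrow> reaches_zero_face n F i y"
  unfolding reaches_zero_face_def by (meson rtranclp.rtrancl_into_rtrancl)

lemma connects_opposite_facesI:
  assumes "i \<in> {1..n}" "reaches_zero_face n F i x" "x i = k i - 1"
  shows "connects_opposite_faces n k F"
proof -
  obtain z where z: "z \<in> F" "z i = 0" "(chain_step n F)\<^sup>*\<^sup>* z x"
    using assms(2) by (auto simp: reaches_zero_face_def)
  then obtain m f where f: "f 0 = z" "f m = x" "\<forall>j<m. chain_step n F (f j) (f (Suc j))"
    using rtranclp_imp_relpowp relpowp_fun_conv by metis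
  have "f j \<in> F" if "j \<le> m" for j
    using that f z(1) by (cases j) (auto simp: chain_step_def)
  moreover have "box_dist n (f (j - 1)) (f j) \<le> 1" if "j \<in> {1..m}" for j
    using that f(3)[rule_format, of "j - 1"] by (auto simp: chain_step_def)
  ultimately show ?thesis
    unfolding connects_opposite_faces_def using assms(1,3) z(2) f(1,2)
    by (intro bexI[of _ i] exI[of _ m] exI[of _ f]) auto
qed

text \<open>Kuhn's lemma makes the number of fully labelled simplices odd, hence nonzero. Closeness
  is stated one-sidedly because \<open>u\<close> and \<open>v\<close> can be swapped.\<close>

lemma kuhn_simplex_exists:
  fixes p :: nat
  assumes "0 < p"
    and "\<And>x j. (\<And>i. x i \<le> p) \<Longrightarrow> j < n \<Longrightarrow> x j = 0 \<Longrightarrow> lab x j = 0"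
    and "\<And>x j. (\<And>i. x i \<le> p) \<Longrightarrow> j < n \<Longrightarrow> x j = p \<Longrightarrow> lab x j = 1"
  obtains s where "(reduced n \<circ> lab) ` s = {..n}" "finite s"
    and "\<And>u v j. u \<in> s \<Longrightarrow> v \<in> s \<Longrightarrow> u j \<le> v j + 1"
proof -
  have "odd (card {s. ksimplex p n s \<and> (reduced n \<circ> lab) ` s = {..n}})"
    using assms by (intro kuhn_combinatorial) auto
  then obtain s where s: "ksimplex p n s" "(reduced n \<circ> lab) ` s = {..n}"
    using odd_card_imp_not_empty by blast
  then obtain b u where "kuhn_simplex p n b u s"
    by (auto elim: ksimplex.cases)
  then interpret kuhn_simplex p n b u s .
  show thesis
  proof (rule that[OF s(2)])
    show "finite s"
      by (simp add: s_eq)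
    \<comment> \<open>In each coordinate, all vertices lie between the base vertex and its
      successor.\<close>
    show "v j \<le> w j + 1" if "v \<in> s" "w \<in> s" for v w j
      using le_Suc_base[OF that(1), of j] base_le[OF that(2), of j] by simp
  qed
qed

text \<open>Clamping also shifts indices: Kuhn's lemma uses coordinates \<open>0..<n\<close>, the box \<open>1..n\<close>.\<close>

definition clamp_to_box :: "nat \<Rightarrow> (nat \<Rightarrow> nat) \<Rightarrow> (nat \<Rightarrow> nat) \<Rightarrow> nat \<Rightarrow> nat" where
  "clamp_to_box n k y = (\<lambda>i\<in>{1..n}. min (y (i - 1)) (k i - 1))"

lemma clamp_to_box_in_box:
  assumes "\<And>i. i \<in> {1..n} \<Longrightarrow> k i > 0"
  shows "clamp_to_box n k y \<in> discrete_box n k"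
  using assms by (fastforce simp: clamp_to_box_def discrete_box_def)

lemma box_dist_clamp_to_box_le_1:
  assumes "n > 0" "\<And>j. u j \<le> v j + 1 \<and> v j \<le> u j + 1"
  shows "box_dist n (clamp_to_box n k u) (clamp_to_box n k v) \<le> 1"
proof (rule box_dist_le_1[OF assms(1)])
  fix i assume "i \<in> {1..n}"
  then show "clamp_to_box n k u i \<le> clamp_to_box n k v i + 1 \<and>
      clamp_to_box n k v i \<le> clamp_to_box n k u i + 1"
    using assms(2)[of "i - 1"] by (auto simp: clamp_to_box_def min_def)
qed

theorem theorem3:
  fixes n :: nat and k :: "nat \<Rightarrow> nat" and \<F> :: "(nat \<Rightarrow> nat) set set"
  assumes "n > 0"
    and "\<And>i. i \<in> {1..n} \<Longrightarrow> k i > 0"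
    and "\<And>F. F \<in> \<F> \<Longrightarrow> F \<subseteq> discrete_box n k"
    and "\<Union>\<F> = discrete_box n k"
  shows "(\<exists>F\<in>\<F>. connects_opposite_faces n k F) \<or>
    (\<exists>B. B \<subseteq> discrete_box n k \<and> box_diameter n B \<le> 1 \<and>
       card {F \<in> \<F>. B \<inter> F \<noteq> {}} \<ge> n + 1)"
proof (cases "\<exists>F\<in>\<F>. connects_opposite_faces n k F")
  case no_conn: False
  let ?r = "clamp_to_box n k"
  \<comment> \<open>An infinite set has \<open>card\<close> 0, so the final comparison of
    cardinalities needs a finite cover.\<close>
  have "finite (discrete_box n k)"
    unfolding discrete_box_def by (intro finite_PiE) auto
  then have fin: "finite \<F>"
    using assms(4) finite_UnionD by metis
  have "\<forall>y. \<exists>F\<in>\<F>. ?r y \<in> F"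
    using clamp_to_box_in_box[of n k] assms(2,4) by blast
  then obtain c where c: "\<And>y. c y \<in> \<F>" "\<And>y. ?r y \<in> c y"
    by metis
  define lab where "lab y j = (if reaches_zero_face n (c y) (Suc j) (?r y) then 0 else 1::nat)" for y j
  \<comment> \<open>Any positive common bound of the side lengths would serve as side of Kuhn's
    cube; clamping then sends its far faces to those of the box.\<close>
  define p where "p = (\<Sum>i\<in>{1..n}. k i)"
  have k_le_p: "k i \<le> p" if "i \<in> {1..n}" for i
    unfolding p_def using that by (intro member_le_sum) auto
  have "0 < p"
    using k_le_p[of 1] assms(1) assms(2)[of 1] by simp
  moreover have "lab y j = 0" if "j < n" "y j = 0" for y j
  proof -
    have "?r y (Suc j) = 0"
      using that by (simp add: clamp_to_box_def)
    \<comment> \<open>The chain of length 0 at \<open>?r y\<close> suffices.\<close>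
    then show ?thesis
      using c(2)[of y] by (auto simp: lab_def reaches_zero_face_def)
  qed
  moreover have "lab y j = 1" if "j < n" "y j = p" for y j
  proof -
    have "?r y (Suc j) = k (Suc j) - 1"
      using that k_le_p[of "Suc j"] by (simp add: clamp_to_box_def)
    then have "\<not> reaches_zero_face n (c y) (Suc j) (?r y)"
      using connects_opposite_facesI[of "Suc j" n "c y" "?r y" k] no_conn c(1)[of y] that(1) by auto
    then show ?thesis
      by (simp add: lab_def)
  qed
  ultimately obtain s where s: "(reduced n \<circ> lab) ` s = {..n}" "finite s"
    and near: "\<And>u v j. u \<in> s \<Longrightarrow> v \<in> s \<Longrightarrow> u j \<le> v j + 1"
    by (rule kuhn_simplex_exists[where lab = lab and n = n]) blast+
  have dist: "box_dist n (?r u) (?r v) \<le> 1" if "u \<in> s" "v \<in> s" for u v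
    using near that assms(1) by (intro box_dist_clamp_to_box_le_1) auto
  \<comment> \<open>A chain from the zero face to \<open>?r u\<close> extends by one step to
    \<open>?r v\<close>, as both points lie in the same member.\<close>
  have lab_le: "lab v j \<le> lab u j" if "u \<in> s" "v \<in> s" "c u = c v" for u v j
    using reaches_zero_face_step[of n "c u" "Suc j" "?r u" "?r v"] dist[OF that(1,2)]
      c(2)[of u] c(2)[of v] that(3)
    by (auto simp: lab_def chain_step_def)
  have lab_eq: "lab u = lab v" if "u \<in> s" "v \<in> s" "c u = c v" for u v
    using lab_le[of u v] lab_le[of v u] that by (intro ext order_antisym) auto
  have "n + 1 = card ((reduced n \<circ> lab) ` s)"
    unfolding s(1) by simp
  \<comment> \<open>By \<open>lab_eq\<close> the reduced label of a vertex depends only on its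
    member of the cover, so it can be read off at a representative vertex; n + 1 labels then force n
    + 1 members.\<close>
  also have "(reduced n \<circ> lab) ` s = (\<lambda>F. reduced n (lab (inv_into s c F))) ` c ` s"
    unfolding image_image comp_def
  proof (rule image_cong[OF refl])
    fix u assume "u \<in> s"
    then show "reduced n (lab u) = reduced n (lab (inv_into s c (c u)))"
      using lab_eq[of u "inv_into s c (c u)"] by (simp add: inv_into_into f_inv_into_f)
  qed
  also have "card \<dots> \<le> card (c ` s)"
    using s(2) by (intro card_image_le) simp
  \<comment> \<open>Each \<open>c u\<close> meets the image of \<open>s\<close> in
    \<open>?r u\<close>.\<close>
  also have "\<dots> \<le> card {F \<in> \<F>. ?r ` s \<inter> F \<noteq> {}}"
    using c fin by (intro card_mono) auto
  finally have "n + 1 \<le> card {F \<in> \<F>. ?r ` s \<inter> F \<noteq> {}}" .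
  moreover have "?r ` s \<subseteq> discrete_box n k"
    using clamp_to_box_in_box[of n k] assms(2) by blast
  moreover have "box_diameter n (?r ` s) \<le> 1"
    using dist by (intro box_diameter_le_1) auto
  ultimately show ?thesis
    by blast
qed blast

end
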